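(* For any pair of positive integers $m, n$, the following two identities hold, as identities of rational functions in the indeterminates $q, x$ (first identity) and $q, x, z$ (second identity): $$\sum_{i=1}^n {n \brack i}\,\frac{(-1)^{i-1}(x+1)(x+q)\cdots(x+q^{i-1})}{(1-q^i)^m}\,q^{mi} \;=\; \sum_{i=1}^{n}\frac{(-1)^{i-1}\bigl(x^i-(-1)^i\bigr)}{1-q^i}\,q^i \sum_{i\leq i_2\leq\cdots\leq i_m\leq n}\frac{q^{\sum_{j=2}^m i_j}}{\prod_{j=2}^m(1-q^{i_j})},$$ and $$\frac{(z;q)_{n+1}}{(q;q)_n}\sum_{i=0}^n {n \brack i}\,\frac{(-1)^{i-1}(x+1)(x+q)\cdots(x+q^{i-1})}{1-zq^i}\,q^i \;=\; \sum_{i=0}^n(-1)^{i-1}\frac{(z;q)_i}{(q;q)_i}\,x^iq^i .$$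
   Context: Here $q, x, z$ are indeterminates. For an integer $i\ge 0$, $(z;q)_i=(1-z)(1-zq)\cdots(1-zq^{i-1})$, with $(z;q)_0=1$; in particular $(q;q)_i=(1-q)(1-q^2)\cdots(1-q^i)$. For integers $0\le i\le n$, ${n \brack i}=\frac{(q;q)_n}{(q;q)_i(q;q)_{n-i}}$ is the Gaussian polynomial. The product $(x+1)(x+q)\cdots(x+q^{i-1})=\prod_{j=0}^{i-1}(x+q^j)$ equals $1$ when $i=0$, and $(-1)^{i-1}=-1$ when $i=0$. The inner sum on the right-hand side of the first identity runs over all integer tuples $(i_2,\ldots,i_m)$ with $i\le i_2\le\cdots\le i_m\le n$; for $m=1$ it consists of the single empty tuple and equals $1$. *)

theory Defs
  imports
    "HOL-Computational_Algebra.Computational_Algebra"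
    "HOL-Library.FuncSet"
begin

definition qpoch :: "'a::comm_ring_1 \<Rightarrow> 'a \<Rightarrow> nat \<Rightarrow> 'a" where
  "qpoch z q i = (\<Prod>j<i. 1 - z * q ^ j)"

text \<open>Only meaningful for \<open>i \<le> n\<close> (the subtraction is truncated) and when \<open>q\<close> is not a root
  of unity, so that no denominator vanishes.\<close>

definition gauss_binomial :: "'a::field \<Rightarrow> nat \<Rightarrow> nat \<Rightarrow> 'a" where
  "gauss_binomial q n i = qpoch q q n / (qpoch q q i * qpoch q q (n - i))"

text \<open>The tuples \<open>(i\<^sub>2, \<dots>, i\<^sub>m)\<close> with \<open>i \<le> i\<^sub>2 \<le> \<dots> \<le> i\<^sub>m \<le> n\<close>, as functions on the index set
  \<open>{2..m}\<close>. They are extensional (undefined outside \<open>{2..m}\<close>), so each tuple is represented by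
  exactly one function; for \<open>m = 1\<close> the only element is the empty tuple.\<close>

definition chain_tuples :: "nat \<Rightarrow> nat \<Rightarrow> nat \<Rightarrow> (nat \<Rightarrow> nat) set" where
  "chain_tuples m i n = {f \<in> {2..m} \<rightarrow>\<^sub>E {i..n}. mono_on {2..m} f}"

text \<open>The field of rational functions in \<open>q, x\<close> over the rationals, as the fraction field of the
  polynomials in \<open>x\<close> over the polynomials in \<open>q\<close>; likewise for \<open>q, x, z\<close>, with \<open>z\<close> outermost.\<close>

type_synonym ratfun_qx = "rat poly poly fract"
type_synonym ratfun_qxz = "rat poly poly poly fract"

definition q2 :: ratfun_qx where "q2 = to_fract [:[:0, 1:]:]"
definition x2 :: ratfun_qx where "x2 = to_fract [:0, 1:]"

definition q3 :: ratfun_qxz where "q3 = to_fract [:[:[:0, 1:]:]:]"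
definition x3 :: ratfun_qxz where "x3 = to_fract [:[:0, 1:]:]"
definition z3 :: ratfun_qxz where "z3 = to_fract [:0, 1:]"

end

theory Submission
  imports Defs
begin

text \<open>
  Both identities are telescoping arguments in \<open>n\<close> over an arbitrary field in which \<open>q\<close> is not a
  root of unity. Write \<open>P\<^sub>i = (x + 1) (x + q) \<dots> (x + q\<^bsup>i - 1\<^esup>)\<close>. Since the ratio of
  \<open>[n, i]\<close> to \<open>[n + 1, i]\<close> is \<open>(1 - q\<^bsup>n + 1 - i\<^esup>) / (1 - q\<^bsup>n + 1\<^esup>)\<close>, raising \<open>n\<close> by one in
  either left-hand side produces a factor \<open>q\<^bsup>n + 1 - i\<^esup>\<close> times exactly one denominator factor
  (\<open>1 - q\<^sup>i\<close>, respectively \<open>1 - z q\<^sup>i\<close>), which cancels one power of the denominator. With all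
  denominators gone the remaining sum is the inversion of the Gauss binomial formula,
  \<open>\<Sum>\<^sub>i [n, i] (-1)\<^sup>i P\<^sub>i = (-x)\<^sup>n\<close> (lemma \<open>gauss_binomial_inversion\<close>), which the \<open>q\<close>-Pascal rule
  gives by induction.

  For the second identity one step of this cancellation is enough: the left-hand sides for
  \<open>n + 1\<close> and \<open>n\<close> differ by the last term on the right.

  For the first identity let \<open>F\<^sub>m(n)\<close> be the left-hand side and \<open>w\<^sub>n = q\<^sup>n / (1 - q\<^sup>n)\<close>. The
  cancellation reads \<open>F\<^sub>m(n + 1) - F\<^sub>m(n) = w\<^sub>n\<^sub>+\<^sub>1 F\<^sub>m\<^sub>-\<^sub>1(n + 1)\<close>. The right-hand side obeys the same
  recurrence, because a weakly increasing tuple bounded by \<open>n + 1\<close> either is bounded by \<open>n\<close> or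
  ends in \<open>n + 1\<close>. The recursions start from \<open>F\<^sub>0(n) = 1 - (-x)\<^sup>n\<close>, which again is the inversion
  formula and explains the factor \<open>(-1)\<^bsup>i - 1\<^esup> (x\<^sup>i - (-1)\<^sup>i)\<close>.
\<close>

section \<open>Gaussian polynomials away from roots of unity\<close>

lemma qpoch_0 [simp]: "qpoch z q 0 = 1"
  by (simp add: qpoch_def)

lemma qpoch_Suc: "qpoch z q (Suc n) = qpoch z q n * (1 - z * q ^ n)"
  by (simp add: qpoch_def)

lemma neg_one_powi_pred: "(-1 :: 'a::field) powi (int i - 1) = - ((-1) ^ i)"
  by (cases i) (simp_all add: power_int_minus)

text \<open>
  The left-hand side of the first identity, where \<open>m = 0\<close> is admitted as the start of a recursion.
\<close>

definition alternating_power_sum :: "'a::field \<Rightarrow> 'a \<Rightarrow> nat \<Rightarrow> nat \<Rightarrow> 'a" where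
  "alternating_power_sum q x m n = (\<Sum>i=1..n. gauss_binomial q n i
      * ((-1) ^ (i - 1) * (\<Prod>j<i. x + q ^ j)) * (q ^ i / (1 - q ^ i)) ^ m)"

context
  fixes q :: "'a::field"
  assumes q_power_neq_1: "\<And>k. k > 0 \<Longrightarrow> q ^ k \<noteq> 1"
begin

lemma one_minus_q_power_neq_0: "k > 0 \<Longrightarrow> 1 - q ^ k \<noteq> 0"
  using q_power_neq_1[of k] by auto

lemma qpoch_q_Suc: "qpoch q q (Suc n) = qpoch q q n * (1 - q ^ Suc n)"
  by (simp add: qpoch_Suc)

lemma qpoch_q_neq_0: "qpoch q q n \<noteq> 0"
  by (induction n) (use one_minus_q_power_neq_0 in \<open>auto simp: qpoch_q_Suc simp del: power_Suc\<close>)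

lemma gauss_binomial_0: "gauss_binomial q n 0 = 1"
  using qpoch_q_neq_0 by (simp add: gauss_binomial_def)

lemma gauss_binomial_self: "gauss_binomial q n n = 1"
  using qpoch_q_neq_0 by (simp add: gauss_binomial_def)

lemma gauss_binomial_raise_top:
  assumes "i \<le> n"
  shows "(1 - q ^ Suc n) * gauss_binomial q n i
    = (1 - q ^ (Suc n - i)) * gauss_binomial q (Suc n) i"
proof -
  have "Suc n - i = Suc (n - i)" using assms by simp
  then show ?thesis
    using one_minus_q_power_neq_0[of "Suc (n - i)"] qpoch_q_neq_0
    by (simp add: gauss_binomial_def qpoch_q_Suc del: power_Suc)
qed

lemma gauss_binomial_absorb:
  "(1 - q ^ Suc n) * gauss_binomial q n i
    = (1 - q ^ Suc i) * gauss_binomial q (Suc n) (Suc i)"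
  using one_minus_q_power_neq_0[of "Suc i"] qpoch_q_neq_0
  by (simp add: gauss_binomial_def qpoch_q_Suc del: power_Suc)

lemma gauss_binomial_Pascal:
  assumes "i < n"
  shows "gauss_binomial q (Suc n) (Suc i)
    = gauss_binomial q n i + q ^ Suc i * gauss_binomial q n (Suc i)"
proof -
  let ?g = "gauss_binomial q (Suc n) (Suc i)"
  have split: "q ^ Suc i * q ^ (Suc n - Suc i) = q ^ Suc n"
    using assms by (simp flip: power_add)
  have "(1 - q ^ Suc n) * (gauss_binomial q n i + q ^ Suc i * gauss_binomial q n (Suc i))
    = (1 - q ^ Suc i) * ?g + q ^ Suc i * ((1 - q ^ (Suc n - Suc i)) * ?g)"
    using gauss_binomial_absorb[of n i] gauss_binomial_raise_top[of "Suc i" n] assms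
    by (simp only: distrib_left mult.left_commute[of _ "q ^ Suc i"] Suc_leI)
  also have "\<dots> = (1 - q ^ Suc i * q ^ (Suc n - Suc i)) * ?g"
    by (simp only: algebra_simps mult_1_left)
  finally show ?thesis
    using one_minus_q_power_neq_0[of "Suc n"] by (simp only: split) simp
qed

text \<open>
  The \<open>q\<close>-Pascal rule splits the sum for \<open>n + 1\<close>. Shifting the index in the first part turns
  \<open>P\<^sub>i\<^sub>+\<^sub>1\<close> into \<open>P\<^sub>i (x + q\<^sup>i)\<close> with the opposite sign, and the \<open>q\<^sup>i\<close> there cancels against the second
  part, so that each step multiplies the sum by \<open>-x\<close>.
\<close>

lemma gauss_binomial_inversion:
  "(\<Sum>i\<le>n. gauss_binomial q n i * ((-1) ^ i * (\<Prod>j<i. x + q ^ j))) = (- x) ^ n"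
proof (induction n)
  case 0
  show ?case by (simp add: gauss_binomial_0)
next
  case (Suc n)
  define b where "b i = (-1) ^ i * (\<Prod>j<i. x + q ^ j)" for i
  have b_Suc: "b (Suc i) = - (x + q ^ i) * b i" for i
    by (simp add: b_def algebra_simps)
  let ?G = "gauss_binomial q"
  have "(\<Sum>i\<le>Suc n. ?G (Suc n) i * b i)
    = b 0 + (\<Sum>i<n. ?G (Suc n) (Suc i) * b (Suc i)) + b (Suc n)"
    unfolding sum.atMost_Suc_shift
    by (simp add: gauss_binomial_0 gauss_binomial_self flip: lessThan_Suc_atMost)
  also have "(\<Sum>i<n. ?G (Suc n) (Suc i) * b (Suc i))
    = (\<Sum>i<n. ?G n i * b (Suc i)) + (\<Sum>i<n. q ^ Suc i * ?G n (Suc i) * b (Suc i))"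
    by (simp add: gauss_binomial_Pascal distrib_right sum.distrib del: power_Suc)
  also have "b 0 + (\<dots>) + b (Suc n)
    = (\<Sum>i\<le>n. ?G n i * b (Suc i)) + (\<Sum>i\<le>n. q ^ i * ?G n i * b i)"
  proof -
    have "(\<Sum>i\<le>n. ?G n i * b (Suc i)) = (\<Sum>i<n. ?G n i * b (Suc i)) + b (Suc n)"
      by (simp add: lessThan_Suc_atMost[symmetric] gauss_binomial_self)
    moreover have "(\<Sum>i\<le>n. q ^ i * ?G n i * b i)
      = b 0 + (\<Sum>i<n. q ^ Suc i * ?G n (Suc i) * b (Suc i))"
      by (simp add: lessThan_Suc_atMost[symmetric] sum.lessThan_Suc_shift gauss_binomial_0
          del: sum.lessThan_Suc power_Suc)
    ultimately show ?thesis by simp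
  qed
  also have "\<dots> = - x * (\<Sum>i\<le>n. ?G n i * b i)"
    by (simp add: b_Suc sum_distrib_left flip: sum.distrib) (simp add: algebra_simps)
  finally show ?case
    using Suc.IH by (simp add: b_def)
qed

section \<open>The identity with one simple pole for each term\<close>

text \<open>
  After both partial fraction sums are written with \<open>[n + 1, i]\<close>, the coefficients combine to
  \<open>(1 - z q\<^bsup>n + 1\<^esup>) - (1 - q\<^bsup>n + 1 - i\<^esup>) = q\<^bsup>n + 1 - i\<^esup> (1 - z q\<^sup>i)\<close>, which removes the pole.
\<close>

lemma partial_fraction_sum_step:
  fixes x z :: 'a
  assumes z: "\<And>k. z * q ^ k \<noteq> 1"
  defines "S n \<equiv> (\<Sum>i\<le>n. gauss_binomial q n i
      * ((-1) ^ i * (\<Prod>j<i. x + q ^ j) / (1 - z * q ^ i)) * q ^ i)"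
  shows "(1 - z * q ^ Suc n) * S (Suc n) = (1 - q ^ Suc n) * S n + (- (x * q)) ^ Suc n"
proof -
  define b where "b i = (-1) ^ i * (\<Prod>j<i. x + q ^ j)" for i
  let ?G = "gauss_binomial q (Suc n)"
  have nz: "1 - z * q ^ k \<noteq> 0" for k using z[of k] by auto
  \<comment> \<open>The added term with index \<open>n + 1\<close> carries the coefficient \<open>1 - q\<^sup>0 = 0\<close>.\<close>
  have "(1 - q ^ Suc n) * S n
    = (\<Sum>i\<le>Suc n. (1 - q ^ (Suc n - i)) * ?G i * (b i / (1 - z * q ^ i)) * q ^ i)"
    by (simp add: S_def b_def sum_distrib_left mult.assoc[symmetric] gauss_binomial_raise_top
        del: power_Suc)
  then have "(1 - z * q ^ Suc n) * S (Suc n) - (1 - q ^ Suc n) * S n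
    = (\<Sum>i\<le>Suc n. ((1 - z * q ^ Suc n) - (1 - q ^ (Suc n - i)))
        * (?G i * (b i / (1 - z * q ^ i)) * q ^ i))"
    unfolding left_diff_distrib sum_subtractf
    by (simp add: S_def b_def sum_distrib_left mult.assoc del: power_Suc sum.atMost_Suc)
  also have "\<dots> = (\<Sum>i\<le>Suc n. q ^ Suc n * (?G i * b i))"
  proof (rule sum.cong[OF refl])
    fix i assume "i \<in> {..Suc n}"
    then have split: "q ^ Suc n = q ^ (Suc n - i) * q ^ i"
      by (simp flip: power_add)
    show "((1 - z * q ^ Suc n) - (1 - q ^ (Suc n - i)))
        * (?G i * (b i / (1 - z * q ^ i)) * q ^ i) = q ^ Suc n * (?G i * b i)"
      unfolding split using nz[of i]
      by (simp add: divide_simps) (simp add: algebra_simps)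
  qed
  also have "\<dots> = (- (x * q)) ^ Suc n"
    using gauss_binomial_inversion[of "Suc n" x]
    by (simp only: b_def mult_minus_left mult.commute[of q] flip: sum_distrib_left power_mult_distrib)
  finally show ?thesis by (simp add: algebra_simps)
qed

lemma partial_fraction_identity:
  assumes z: "\<And>k. z * q ^ k \<noteq> 1"
  shows "qpoch z q (Suc n) / qpoch q q n
      * (\<Sum>i\<le>n. gauss_binomial q n i
          * ((-1) ^ i * (\<Prod>j<i. x + q ^ j) / (1 - z * q ^ i)) * q ^ i)
    = (\<Sum>i\<le>n. (-1) ^ i * (qpoch z q i / qpoch q q i) * x ^ i * q ^ i)"
proof (induction n)
  case 0
  show ?case using z[of 0] by (simp add: gauss_binomial_0 qpoch_Suc)
next
  case (Suc n)
  define S where "S n = (\<Sum>i\<le>n. gauss_binomial q n i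
      * ((-1) ^ i * (\<Prod>j<i. x + q ^ j) / (1 - z * q ^ i)) * q ^ i)" for n
  have nz: "1 - q ^ Suc n \<noteq> 0" using one_minus_q_power_neq_0[of "Suc n"] by simp
  have "qpoch z q (Suc (Suc n)) / qpoch q q (Suc n) * S (Suc n)
    = qpoch z q (Suc n) / qpoch q q (Suc n) * ((1 - z * q ^ Suc n) * S (Suc n))"
    by (simp only: qpoch_Suc[of z q "Suc n"]) simp
  also have "(1 - z * q ^ Suc n) * S (Suc n) = (1 - q ^ Suc n) * S n + (- (x * q)) ^ Suc n"
    unfolding S_def by (rule partial_fraction_sum_step[OF z])
  also have "qpoch z q (Suc n) / qpoch q q (Suc n) * \<dots>
    = qpoch z q (Suc n) / qpoch q q n * S n
      + (-1) ^ Suc n * (qpoch z q (Suc n) / qpoch q q (Suc n)) * x ^ Suc n * q ^ Suc n"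
  proof -
    have "(- (x * q)) ^ Suc n = (-1) ^ Suc n * x ^ Suc n * q ^ Suc n"
      by (metis mult_minus1 power_mult_distrib mult.assoc)
    moreover have "qpoch z q (Suc n) / qpoch q q (Suc n) * ((1 - q ^ Suc n) * S n)
      = qpoch z q (Suc n) / qpoch q q n * S n"
      using nz by (simp add: qpoch_q_Suc del: power_Suc)
    ultimately show ?thesis by (simp only: distrib_left ac_simps)
  qed
  finally show ?case using Suc.IH by (simp only: S_def sum.atMost_Suc)
qed

section \<open>The identity with poles of higher order\<close>

lemma alternating_power_sum_0: "alternating_power_sum q x 0 n = 1 - (- x) ^ n"
proof -
  let ?t = "\<lambda>i. gauss_binomial q n i * ((-1) ^ i * (\<Prod>j<i. x + q ^ j))"
  have "{..n} = insert 0 {1..n}" by auto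
  then have "(- x) ^ n = 1 + (\<Sum>i=1..n. ?t i)"
    by (simp add: gauss_binomial_0 flip: gauss_binomial_inversion[of n x])
  also have "(\<Sum>i=1..n. ?t i) = (\<Sum>i=1..n. - (gauss_binomial q n i
      * ((-1) ^ (i - 1) * (\<Prod>j<i. x + q ^ j))))"
    by (rule sum.cong[OF refl]) (simp add: power_eq_if)
  finally show ?thesis by (simp add: alternating_power_sum_def sum_negf)
qed

text \<open>
  The identity \<open>1 - q\<^bsup>n + 1\<^esup> = (1 - q\<^bsup>n + 1 - i\<^esup>) + q\<^bsup>n + 1 - i\<^esup> (1 - q\<^sup>i)\<close> accounts for the difference
  of the Gaussian polynomials: its last term lowers the power of \<open>w\<^sub>i\<close> by one.
\<close>

lemma alternating_power_sum_Suc: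
  "alternating_power_sum q x (Suc m) (Suc n) = alternating_power_sum q x (Suc m) n
    + q ^ Suc n / (1 - q ^ Suc n) * alternating_power_sum q x m (Suc n)"
proof -
  define b where "b i = (-1) ^ (i - 1) * (\<Prod>j<i. x + q ^ j)" for i
  define w where "w i = q ^ i / (1 - q ^ i)" for i
  let ?G = "gauss_binomial q (Suc n)"
  define D where "D = 1 - q ^ Suc n"
  have D: "D \<noteq> 0" using one_minus_q_power_neq_0[of "Suc n"] by (simp add: D_def)
  \<comment> \<open>The added term with index \<open>n + 1\<close> carries the coefficient \<open>1 - q\<^sup>0 = 0\<close>.\<close>
  have "D * alternating_power_sum q x (Suc m) n
    = (\<Sum>i=1..Suc n. (1 - q ^ (Suc n - i)) * ?G i * b i * w i ^ Suc m)"
    by (simp add: D_def alternating_power_sum_def b_def w_def sum_distrib_left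
        mult.assoc[symmetric] gauss_binomial_raise_top del: power_Suc)
  moreover have "q ^ Suc n * alternating_power_sum q x m (Suc n)
    = (\<Sum>i=1..Suc n. q ^ (Suc n - i) * (1 - q ^ i) * ?G i * b i * w i ^ Suc m)"
    unfolding alternating_power_sum_def sum_distrib_left
  proof (rule sum.cong[OF refl])
    fix i assume i: "i \<in> {1..Suc n}"
    then have split: "q ^ Suc n = q ^ (Suc n - i) * q ^ i"
      by (simp flip: power_add)
    have "(1 - q ^ i) * w i = q ^ i"
      using i one_minus_q_power_neq_0[of i] by (simp add: w_def)
    then have lower: "q ^ i * w i ^ m = (1 - q ^ i) * w i ^ Suc m"
      by (simp add: mult.assoc[symmetric])
    have "q ^ Suc n * (?G i * b i * w i ^ m) = q ^ (Suc n - i) * ?G i * b i * (q ^ i * w i ^ m)"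
      unfolding split by (simp only: ac_simps)
    then show "q ^ Suc n * (?G i * ((-1) ^ (i - 1) * (\<Prod>j<i. x + q ^ j))
        * (q ^ i / (1 - q ^ i)) ^ m)
      = q ^ (Suc n - i) * (1 - q ^ i) * ?G i * b i * w i ^ Suc m"
      unfolding lower b_def[symmetric] w_def[symmetric] by (simp only: ac_simps)
  qed
  ultimately have "D * alternating_power_sum q x (Suc m) n
      + q ^ Suc n * alternating_power_sum q x m (Suc n)
    = (\<Sum>i=1..Suc n. ((1 - q ^ (Suc n - i)) + q ^ (Suc n - i) * (1 - q ^ i))
        * ?G i * b i * w i ^ Suc m)"
    by (simp only: distrib_right sum.distrib)
  also have "\<dots> = (\<Sum>i=1..Suc n. D * (?G i * b i * w i ^ Suc m))"
  proof (rule sum.cong[OF refl])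
    fix i assume "i \<in> {1..Suc n}"
    then have "q ^ (Suc n - i) * q ^ i = q ^ Suc n"
      by (simp flip: power_add)
    then have "(1 - q ^ (Suc n - i)) + q ^ (Suc n - i) * (1 - q ^ i) = D"
      by (simp add: D_def right_diff_distrib del: power_Suc)
    then show "((1 - q ^ (Suc n - i)) + q ^ (Suc n - i) * (1 - q ^ i))
        * ?G i * b i * w i ^ Suc m = D * (?G i * b i * w i ^ Suc m)"
      by (simp only: mult.assoc)
  qed
  also have "\<dots> = D * alternating_power_sum q x (Suc m) (Suc n)"
    by (simp only: alternating_power_sum_def b_def w_def flip: sum_distrib_left)
  finally show ?thesis
    using D by (simp add: D_def[symmetric] field_simps del: power_Suc)
qed

end

text \<open>
  A tuple with entries at most \<open>n + 1\<close> is determined by its first entries if its last entry is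
  \<open>n + 1\<close>; otherwise monotonicity bounds all its entries by \<open>n\<close>.
\<close>

lemma chain_tuples_Suc:
  assumes "m \<ge> 1" and "i \<le> Suc n"
  shows "chain_tuples (Suc m) i (Suc n)
    = chain_tuples (Suc m) i n \<union> (\<lambda>f. f(Suc m := Suc n)) ` chain_tuples m i (Suc n)"
    (is "?A = ?B \<union> ?C")
proof (intro equalityI subsetI)
  fix f assume f: "f \<in> ?A"
  then have fE: "f \<in> {2..Suc m} \<rightarrow>\<^sub>E {i..Suc n}" and mono: "mono_on {2..Suc m} f"
    by (auto simp: chain_tuples_def)
  have top: "Suc m \<in> {2..Suc m}" using assms by simp
  show "f \<in> ?B \<union> ?C"
  proof (cases "f (Suc m) = Suc n")
    case True
    define g where "g = f(Suc m := undefined)"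
    have "g \<in> chain_tuples m i (Suc n)"
      using fE mono by (auto simp: chain_tuples_def g_def PiE_iff extensional_def mono_on_def)
    moreover have "f = g(Suc m := Suc n)"
      using True by (auto simp: g_def)
    ultimately show ?thesis by blast
  next
    case False
    then have "f (Suc m) \<le> n" using PiE_mem[OF fE top] by simp
    moreover have "f j \<le> f (Suc m)" if "j \<in> {2..Suc m}" for j
      using mono that top by (auto simp: mono_on_def)
    ultimately have "f j \<le> n" if "j \<in> {2..Suc m}" for j
      using that order_trans by blast
    then show ?thesis
      using fE mono by (auto simp: chain_tuples_def PiE_iff)
  qed
next
  fix f assume "f \<in> ?B \<union> ?C"
  then show "f \<in> ?A"
  proof
    assume "f \<in> ?B"
    then show ?thesis by (fastforce simp: chain_tuples_def PiE_iff)
  next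
    assume "f \<in> ?C"
    then obtain g where g: "g \<in> {2..m} \<rightarrow>\<^sub>E {i..Suc n}" "mono_on {2..m} g"
      and f: "f = g(Suc m := Suc n)"
      by (auto simp: chain_tuples_def)
    have "f \<in> {2..Suc m} \<rightarrow>\<^sub>E {i..Suc n}"
      using g(1) assms by (auto simp: f PiE_iff extensional_def)
    moreover have "mono_on {2..Suc m} f"
      using g by (auto simp: f mono_on_def PiE_iff le_Suc_eq)
    ultimately show ?thesis by (simp add: chain_tuples_def)
  qed
qed

lemma finite_chain_tuples: "finite (chain_tuples m i n)"
proof -
  have "finite ({2..m} \<rightarrow>\<^sub>E {i..n})" by (intro finite_PiE) auto
  then show ?thesis by (rule rev_finite_subset) (auto simp: chain_tuples_def)
qed

lemma chain_tuples_1: "chain_tuples 1 i n = {\<lambda>_. undefined}"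
  by (auto simp: chain_tuples_def mono_on_def)

lemma chain_tuples_empty: "m \<ge> 2 \<Longrightarrow> n < i \<Longrightarrow> chain_tuples m i n = {}"
  by (fastforce simp: chain_tuples_def PiE_iff)

text \<open>
  The sum over \<open>chain_tuples m i n\<close> is the complete homogeneous symmetric polynomial of degree
  \<open>m - 1\<close> in \<open>w\<^sub>i, \<dots>, w\<^sub>n\<close>; this is its usual recursion on the last variable.
\<close>

lemma sum_chain_tuples_Suc:
  fixes w :: "nat \<Rightarrow> 'a::comm_ring_1"
  assumes "m \<ge> 1" and "i \<le> Suc n"
  shows "(\<Sum>f\<in>chain_tuples (Suc m) i (Suc n). \<Prod>j=2..Suc m. w (f j))
    = (\<Sum>f\<in>chain_tuples (Suc m) i n. \<Prod>j=2..Suc m. w (f j))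
      + w (Suc n) * (\<Sum>f\<in>chain_tuples m i (Suc n). \<Prod>j=2..m. w (f j))"
proof -
  let ?u = "\<lambda>f. f(Suc m := Suc n)"
  have inj: "inj_on ?u (chain_tuples m i (Suc n))"
  proof (rule inj_onI)
    fix f g assume f: "f \<in> chain_tuples m i (Suc n)" and g: "g \<in> chain_tuples m i (Suc n)"
      and eq: "?u f = ?u g"
    \<comment> \<open>Extensional functions on \<open>{2..m}\<close> agree at \<open>m + 1\<close>.\<close>
    have "f (Suc m) = g (Suc m)"
      using f g by (simp add: chain_tuples_def PiE_iff extensional_def)
    with eq show "f = g" by (metis fun_upd_triv fun_upd_upd)
  qed
  have disjoint: "chain_tuples (Suc m) i n \<inter> ?u ` chain_tuples m i (Suc n) = {}"
  proof -
    have "f (Suc m) \<noteq> Suc n" if "f \<in> chain_tuples (Suc m) i n" for f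
    proof -
      have "f \<in> {2..Suc m} \<rightarrow>\<^sub>E {i..n}" using that by (simp add: chain_tuples_def)
      then have "f (Suc m) \<in> {i..n}" by (rule PiE_mem) (use assms in simp)
      then show ?thesis by simp
    qed
    then show ?thesis by fastforce
  qed
  have "(\<Prod>j=2..Suc m. w (?u f j)) = w (Suc n) * (\<Prod>j=2..m. w (f j))" for f
    using assms by (simp add: mult.commute)
  then show ?thesis
    using assms inj disjoint
    by (simp add: chain_tuples_Suc sum.union_disjoint finite_chain_tuples sum.reindex
        sum_distrib_left del: prod.cl_ivl_Suc)
qed

text \<open>
  Both sides satisfy the same recursion in \<open>n\<close> and in the number \<open>m\<close> of factors \<open>w\<close>. For \<open>m = 1\<close>
  the only tuple is empty, and raising \<open>n\<close> adds \<open>w\<^sub>n\<^sub>+\<^sub>1 (1 - (-x)\<^bsup>n + 1\<^esup>)\<close> on either side.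
\<close>

lemma alternating_power_sum_eq_chain_sum:
  fixes q x :: "'a::field"
  assumes q: "\<And>k. k > 0 \<Longrightarrow> q ^ k \<noteq> 1"
  defines "w k \<equiv> q ^ k / (1 - q ^ k)"
  assumes "m \<ge> 1"
  shows "alternating_power_sum q x m n
    = (\<Sum>i=1..n. (1 - (- x) ^ i) * w i * (\<Sum>f\<in>chain_tuples m i n. \<Prod>j=2..m. w (f j)))"
  using \<open>m \<ge> 1\<close>
proof (induction m arbitrary: n rule: dec_induct)
  case base
  show ?case
  proof (induction n)
    case 0
    show ?case by (simp add: alternating_power_sum_def)
  next
    case (Suc n)
    have "alternating_power_sum q x 1 (Suc n)
      = alternating_power_sum q x 1 n + w (Suc n) * (1 - (- x) ^ Suc n)"
      using alternating_power_sum_Suc[OF q, of x 0 n] alternating_power_sum_0[OF q, of x "Suc n"]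
      by (simp add: w_def)
    then show ?case
      using Suc.IH by (simp only: chain_tuples_1) (simp add: mult.commute)
  qed
next
  case (step m)
  show ?case
  proof (induction n)
    case 0
    show ?case by (simp add: alternating_power_sum_def)
  next
    case (Suc n)
    define c where "c i = (1 - (- x) ^ i) * w i" for i
    define H where "H m i n = (\<Sum>f\<in>chain_tuples m i n. \<Prod>j=2..m. w (f j))" for m i n
    \<comment> \<open>No tuple fits between \<open>n + 1\<close> and \<open>n\<close>, so the outer sum may run up to \<open>n + 1\<close> as well.\<close>
    have "H (Suc m) (Suc n) n = 0"
      using step.hyps by (simp add: H_def chain_tuples_empty)
    then have "(\<Sum>i=1..n. c i * H (Suc m) i n) = (\<Sum>i=1..Suc n. c i * H (Suc m) i n)"
      by simp
    moreover have "alternating_power_sum q x (Suc m) (Suc n)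
      = (\<Sum>i=1..n. c i * H (Suc m) i n) + w (Suc n) * (\<Sum>i=1..Suc n. c i * H m i (Suc n))"
      using alternating_power_sum_Suc[OF q, of x m n] Suc.IH step.IH[of "Suc n"]
      by (simp only: c_def H_def w_def)
    ultimately have "alternating_power_sum q x (Suc m) (Suc n)
      = (\<Sum>i=1..Suc n. c i * (H (Suc m) i n + w (Suc n) * H m i (Suc n)))"
      by (simp only: sum_distrib_left distrib_left sum.distrib mult.left_commute[of "w (Suc n)"])
    also have "\<dots> = (\<Sum>i=1..Suc n. c i * H (Suc m) i (Suc n))"
    proof (rule sum.cong[OF refl])
      fix i assume "i \<in> {1..Suc n}"
      then show "c i * (H (Suc m) i n + w (Suc n) * H m i (Suc n)) = c i * H (Suc m) i (Suc n)"
        using sum_chain_tuples_Suc[of m i n w] step.hyps by (simp only: H_def atLeastAtMost_iff)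
    qed
    finally show ?case by (simp only: c_def H_def)
  qed
qed

lemma higher_order_pole_identity:
  fixes q x :: "'a::field"
  assumes q: "\<And>k. k > 0 \<Longrightarrow> q ^ k \<noteq> 1" and "m \<ge> 1"
  shows "(\<Sum>i=1..n. gauss_binomial q n i
        * ((-1) ^ (i - 1) * (\<Prod>j<i. x + q ^ j) / (1 - q ^ i) ^ m) * q ^ (m * i))
    = (\<Sum>i=1..n. (-1) ^ (i - 1) * (x ^ i - (-1) ^ i) / (1 - q ^ i) * q ^ i
        * (\<Sum>f\<in>chain_tuples m i n. q ^ (\<Sum>j=2..m. f j) / (\<Prod>j=2..m. 1 - q ^ f j)))"
    (is "?L = ?R")
proof -
  have "?L = alternating_power_sum q x m n"
    unfolding alternating_power_sum_def
  proof (rule sum.cong[OF refl])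
    fix i
    have "q ^ (m * i) = (q ^ i) ^ m" by (simp add: mult.commute flip: power_mult)
    then show "gauss_binomial q n i
        * ((-1) ^ (i - 1) * (\<Prod>j<i. x + q ^ j) / (1 - q ^ i) ^ m) * q ^ (m * i)
      = gauss_binomial q n i * ((-1) ^ (i - 1) * (\<Prod>j<i. x + q ^ j))
        * (q ^ i / (1 - q ^ i)) ^ m"
      by (simp add: power_divide)
  qed
  moreover have "?R = (\<Sum>i=1..n. (1 - (- x) ^ i) * (q ^ i / (1 - q ^ i))
      * (\<Sum>f\<in>chain_tuples m i n. \<Prod>j=2..m. q ^ f j / (1 - q ^ f j)))"
  proof (rule sum.cong[OF refl])
    fix i assume "i \<in> {1..n}"
    then obtain k where "i = Suc k" by (cases i) auto
    moreover have "(-1) ^ k * (-1) ^ k = (1 :: 'a)" for k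
      by (simp flip: power_mult_distrib)
    ultimately have "(-1) ^ (i - 1) * (x ^ i - (-1) ^ i) = 1 - (- x) ^ i"
      by (simp add: power_minus[of x] algebra_simps)
    then show "(-1) ^ (i - 1) * (x ^ i - (-1) ^ i) / (1 - q ^ i) * q ^ i
        * (\<Sum>f\<in>chain_tuples m i n. q ^ (\<Sum>j=2..m. f j) / (\<Prod>j=2..m. 1 - q ^ f j))
      = (1 - (- x) ^ i) * (q ^ i / (1 - q ^ i))
        * (\<Sum>f\<in>chain_tuples m i n. \<Prod>j=2..m. q ^ f j / (1 - q ^ f j))"
      by (simp add: prod_dividef power_sum)
  qed
  ultimately show ?thesis
    using alternating_power_sum_eq_chain_sum[OF q \<open>m \<ge> 1\<close>, of x n] by (simp only:)
qed

section \<open>The indeterminates\<close>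

lemma to_fract_power: "to_fract (p ^ k) = to_fract p ^ k"
  by (induction k) simp_all

lemma q2_power_neq_1: "k > 0 \<Longrightarrow> q2 ^ k \<noteq> 1"
proof
  assume "k > 0" and "q2 ^ k = 1"
  then have "to_fract ([:[:0, 1:]:] ^ k :: rat poly poly) = to_fract 1"
    by (simp add: q2_def to_fract_power)
  then have "[:[:0, 1::rat:] ^ k:] = 1"
    by (simp only: to_fract_eq_iff poly_const_pow)
  then have "degree ([:0, 1::rat:] ^ k) = 0" by (simp add: one_pCons)
  with \<open>k > 0\<close> show False by (simp add: degree_power_eq)
qed

lemma q3_power_neq_1: "k > 0 \<Longrightarrow> q3 ^ k \<noteq> 1"
proof
  assume "k > 0" and "q3 ^ k = 1"
  then have "to_fract ([:[:[:0, 1:]:]:] ^ k :: rat poly poly poly) = to_fract 1"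
    by (simp add: q3_def to_fract_power)
  then have "[:[:[:0, 1::rat:] ^ k:]:] = 1"
    by (simp only: to_fract_eq_iff poly_const_pow)
  then have "degree ([:0, 1::rat:] ^ k) = 0" by (simp add: one_pCons)
  with \<open>k > 0\<close> show False by (simp add: degree_power_eq)
qed

lemma z3_q3_power_neq_1: "z3 * q3 ^ k \<noteq> 1"
proof
  assume "z3 * q3 ^ k = 1"
  then have "to_fract ([:0, 1:] * [:[:[:0, 1:]:]:] ^ k :: rat poly poly poly) = to_fract 1"
    by (simp only: z3_def q3_def to_fract_power to_fract_mult to_fract_1)
  then have "[:0, 1:] * [:[:[:0, 1::rat:]:]:] ^ k = 1"
    by (simp only: to_fract_eq_iff)
  \<comment> \<open>The left-hand side vanishes at \<open>z = 0\<close>.\<close>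
  then have "poly ([:0, 1:] * [:[:[:0, 1::rat:]:]:] ^ k) 0 = poly 1 0" by (rule arg_cong)
  then show False by simp
qed

theorem theorem1p1:
  fixes m n :: nat
  assumes "m \<ge> 1" and "n \<ge> 1"
  shows
    "(let q = q2; x = x2 in
       (\<Sum>i=1..n. gauss_binomial q n i
           * ((-1) ^ (i - 1) * (\<Prod>j<i. x + q ^ j) / (1 - q ^ i) ^ m) * q ^ (m * i))
       = (\<Sum>i=1..n. (-1) ^ (i - 1) * (x ^ i - (-1) ^ i) / (1 - q ^ i) * q ^ i
           * (\<Sum>f\<in>chain_tuples m i n. q ^ (\<Sum>j=2..m. f j) / (\<Prod>j=2..m. 1 - q ^ f j))))
     \<and>
     (let q = q3; x = x3; z = z3 in
       qpoch z q (n + 1) / qpoch q q n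
         * (\<Sum>i=0..n. gauss_binomial q n i
             * ((-1) powi (int i - 1) * (\<Prod>j<i. x + q ^ j) / (1 - z * q ^ i)) * q ^ i)
       = (\<Sum>i=0..n. (-1) powi (int i - 1) * (qpoch z q i / qpoch q q i) * x ^ i * q ^ i))"
proof -
  have "(\<Sum>i=1..n. gauss_binomial q2 n i
        * ((-1) ^ (i - 1) * (\<Prod>j<i. x2 + q2 ^ j) / (1 - q2 ^ i) ^ m) * q2 ^ (m * i))
    = (\<Sum>i=1..n. (-1) ^ (i - 1) * (x2 ^ i - (-1) ^ i) / (1 - q2 ^ i) * q2 ^ i
        * (\<Sum>f\<in>chain_tuples m i n. q2 ^ (\<Sum>j=2..m. f j) / (\<Prod>j=2..m. 1 - q2 ^ f j)))"
    by (rule higher_order_pole_identity[OF q2_power_neq_1 \<open>m \<ge> 1\<close>])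
  moreover have "qpoch z3 q3 (n + 1) / qpoch q3 q3 n
      * (\<Sum>i=0..n. gauss_binomial q3 n i
          * ((-1) powi (int i - 1) * (\<Prod>j<i. x3 + q3 ^ j) / (1 - z3 * q3 ^ i)) * q3 ^ i)
    = (\<Sum>i=0..n. (-1) powi (int i - 1) * (qpoch z3 q3 i / qpoch q3 q3 i) * x3 ^ i * q3 ^ i)"
    using partial_fraction_identity[OF q3_power_neq_1 z3_q3_power_neq_1, of n x3]
    by (simp add: neg_one_powi_pred sum_negf atLeast0AtMost)
  ultimately show ?thesis by (simp only: Let_def)
qed

end
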